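(* Let $G>I$ be a finite group with $Z(G)=I$ and let $\sigma_1,\sigma_2\in G$ with $G=\langle\sigma_1,\sigma_2\rangle$, $o(\sigma_1\sigma_2)=2$ and $[\sigma_1]=[\sigma_2]=:C$ (i.e. $\sigma_1,\sigma_2$ conjugate). Put $e_1=[\sigma_1,\sigma_1,\sigma_2,\sigma_1\sigma_2\sigma_1^{-1}]$, $e_2=[\sigma_1,\sigma_2\sigma_1\sigma_2^{-1},\sigma_2,\sigma_2]$, $e_3=[\sigma_1,\sigma_2,\sigma_1,\sigma_2]$, $e_4=[\sigma_1,\sigma_2,\sigma_2^{-1}\sigma_1\sigma_2,\sigma_1\sigma_2\sigma_1^{-1}]$, $e_5=[\sigma_1,\sigma_2,\sigma_2,\sigma_2^{-1}\sigma_1\sigma_2]$, $e_6=[\sigma_1,\sigma_2,\sigma_1\sigma_2\sigma_1^{-1},\sigma_1]$, all in $\Sigma^i(C,C,C,C)$. Then $Z^{sy}=\{e_1,\dots,e_6\}$ is an orbit of length $6$ under the group $B_4^{sy}$ of permutations of $\Sigma^i(C,C,C,C)$ generated by $\beta_{12},\beta_{13},\beta_{14},\beta_3,\eta_{23},\eta_{234}$, and, identifying $e_i$ with $i$, $\rho_4(\beta_{12})=(1)(2)(3,4)(5,6)$, $\rho_4(\beta_{13})=(1,2)(3)(4)(5,6)$, $\rho_4(\beta_{14})=(1,2)(3,4)(5)(6)$, $\rho_4(\beta_3)=(1,3,2,4)(5)(6)$, $\rho_4(\eta_{23})=(1,4)(2,3)(5,6)$, $\rho_4(\eta_{234})=(1,6,4)(2,5,3)$;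 moreover $\rho_4(B_4)\cong C_2\times C_2<A_6$ and $\rho_4(B_4^{sy})\cong\rho_4(T)\cong S_4<S_6$ for $T=\langle\beta_3,\eta_{23},\eta_{234}\rangle$, and $g_{Z^{sy}}=0$.
   Context: $\iota$ is the identity, $I$ the trivial group. $\Sigma^i(C_1,\dots,C_4)$ is the set of $G$-conjugacy classes $[\sigma_1,\dots,\sigma_4]$ (simultaneous conjugation) of tuples with $\sigma_j\in C_j$, $\langle\sigma_1,\dots,\sigma_4\rangle=G$, $\sigma_1\sigma_2\sigma_3\sigma_4=\iota$. Braids act from the right: $[\underline{\sigma}]^{\beta_2}=[\sigma_1\sigma_2\sigma_1^{-1},\sigma_1,\sigma_3,\sigma_4]$, $[\underline{\sigma}]^{\beta_3}=[\sigma_1,\sigma_2\sigma_3\sigma_2^{-1},\sigma_2,\sigma_4]$, $[\underline{\sigma}]^{\beta_4}=[\sigma_1,\sigma_2,\sigma_3\sigma_4\sigma_3^{-1},\sigma_3]$; $\beta_{12}=\beta_2^2$, $\beta_{13}=\beta_2^{-1}\beta_3^2\beta_2$, $\beta_{14}=\beta_2^{-1}\beta_3^{-1}\beta_4^2\beta_3\beta_2$; $B_4$ is the pure braid group generated by $\beta_{12},\beta_{13},\beta_{14},\beta_{23}=\beta_3^2,\beta_{24}=\beta_3^{-1}\beta_4^2\beta_3,\beta_{34}=\beta_4^2$. The topological automorphisms act on $\Sigma^i(C,C,C,C)$ by $[\underline{\sigma}]^{\eta_{23}}=[\sigma_2^{-1}\sigma_1\sigma_2,\sigma_3,\sigma_4\sigma_2\sigma_4^{-1},\sigma_4]$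 and $[\underline{\sigma}]^{\eta_{234}}=[\sigma_1,\sigma_2\sigma_3\sigma_2^{-1},\sigma_2\sigma_4\sigma_2^{-1},\sigma_2]$. $\rho_4$ denotes the induced permutation representation on $Z^{sy}$. The genus of an orbit $Z^{sy}$ (for the symmetry group $\langle(2,3),(2,3,4)\rangle$) is $g_{Z^{sy}}=1-|Z^{sy}|+\frac12(3|Z^{sy}|-z_3-z_{23}-z_{234})$, where $z_3,z_{23},z_{234}$ are the numbers of cycles (fixed points included) of $\rho_4(\beta_3),\rho_4(\eta_{23}),\rho_4(\eta_{234})$ on $Z^{sy}$. *)

theory Defs
  imports "HOL-Algebra.Algebra" "HOL-Combinatorics.Cycles"
begin

type_synonym 'a tup4 = "'a \<times> 'a \<times> 'a \<times> 'a"

context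
  fixes G :: "('a, 'b) monoid_scheme" (structure)
begin

definition center :: "'a set" where
  "center = {z \<in> carrier G. \<forall>g \<in> carrier G. z \<otimes> g = g \<otimes> z}"

definition conjcl :: "'a \<Rightarrow> 'a set" where
  "conjcl x = {inv g \<otimes> x \<otimes> g | g. g \<in> carrier G}"

fun tconj :: "'a \<Rightarrow> 'a tup4 \<Rightarrow> 'a tup4" where
  "tconj g (a, b, c, d) = (inv g \<otimes> a \<otimes> g, inv g \<otimes> b \<otimes> g, inv g \<otimes> c \<otimes> g, inv g \<otimes> d \<otimes> g)"

definition tcls :: "'a tup4 \<Rightarrow> 'a tup4 set" where
  "tcls t = {tconj g t | g. g \<in> carrier G}"

definition Sigma_i :: "'a set \<Rightarrow> 'a tup4 set set" where
  "Sigma_i C = {tcls (a, b, c, d) | a b c d.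
      a \<in> C \<and> b \<in> C \<and> c \<in> C \<and> d \<in> C \<and>
      generate G {a, b, c, d} = carrier G \<and> a \<otimes> b \<otimes> c \<otimes> d = \<one>}"

fun br2 :: "'a tup4 \<Rightarrow> 'a tup4" where
  "br2 (a, b, c, d) = (a \<otimes> b \<otimes> inv a, a, c, d)"
fun br2i :: "'a tup4 \<Rightarrow> 'a tup4" where
  "br2i (a, b, c, d) = (b, inv b \<otimes> a \<otimes> b, c, d)"
fun br3 :: "'a tup4 \<Rightarrow> 'a tup4" where
  "br3 (a, b, c, d) = (a, b \<otimes> c \<otimes> inv b, b, d)"
fun br3i :: "'a tup4 \<Rightarrow> 'a tup4" where
  "br3i (a, b, c, d) = (a, c, inv c \<otimes> b \<otimes> c, d)"
fun br4 :: "'a tup4 \<Rightarrow> 'a tup4" where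
  "br4 (a, b, c, d) = (a, b, c \<otimes> d \<otimes> inv c, c)"
fun br4i :: "'a tup4 \<Rightarrow> 'a tup4" where
  "br4i (a, b, c, d) = (a, b, d, inv d \<otimes> c \<otimes> d)"
fun eta23 :: "'a tup4 \<Rightarrow> 'a tup4" where
  "eta23 (a, b, c, d) = (inv b \<otimes> a \<otimes> b, c, d \<otimes> b \<otimes> inv d, d)"
fun eta234 :: "'a tup4 \<Rightarrow> 'a tup4" where
  "eta234 (a, b, c, d) = (a, b \<otimes> c \<otimes> inv b, b \<otimes> d \<otimes> inv b, b)"

text \<open>Pure braids. The action is a right action, so the word x y acts as the function y o x.\<close>
definition b12 where "b12 = br2 \<circ> br2"
definition b13 where "b13 = br2 \<circ> br3 \<circ> br3 \<circ> br2i"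
definition b14 where "b14 = br2 \<circ> br3 \<circ> br4 \<circ> br4 \<circ> br3i \<circ> br2i"
definition b23 where "b23 = br3 \<circ> br3"
definition b24 where "b24 = br3 \<circ> br4 \<circ> br4 \<circ> br3i"
definition b34 where "b34 = br4 \<circ> br4"

fun etup :: "'a \<Rightarrow> 'a \<Rightarrow> nat \<Rightarrow> 'a tup4" where
  "etup s1 s2 i =
    (if i = 1 then (s1, s1, s2, s1 \<otimes> s2 \<otimes> inv s1)
     else if i = 2 then (s1, s2 \<otimes> s1 \<otimes> inv s2, s2, s2)
     else if i = 3 then (s1, s2, s1, s2)
     else if i = 4 then (s1, s2, inv s2 \<otimes> s1 \<otimes> s2, s1 \<otimes> s2 \<otimes> inv s1)
     else if i = 5 then (s1, s2, s2, inv s2 \<otimes> s1 \<otimes> s2)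
     else (s1, s2, s1 \<otimes> s2 \<otimes> inv s1, s1))"

definition ecls :: "'a \<Rightarrow> 'a \<Rightarrow> nat \<Rightarrow> 'a tup4 set" where
  "ecls s1 s2 i = tcls (etup s1 s2 i)"

end

definition clsmap :: "('t \<Rightarrow> 't) \<Rightarrow> 't set \<Rightarrow> 't set" where
  "clsmap f Y = image f Y"

definition perm_orbit :: "'s set \<Rightarrow> ('s \<Rightarrow> 's) set \<Rightarrow> 's \<Rightarrow> 's set" where
  "perm_orbit S Fs x = {p x | p. p \<in> generate (BijGroup S) ((\<lambda>f. restrict f S) ` Fs)}"

definition rho4 :: "(nat \<Rightarrow> 's) \<Rightarrow> ('s \<Rightarrow> 's) \<Rightarrow> nat \<Rightarrow> nat" where
  "rho4 e f = (\<lambda>i. if i \<in> {1..6} then (THE j. j \<in> {1..6} \<and> f (e i) = e j) else i)"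

definition ncycles :: "'s set \<Rightarrow> ('s \<Rightarrow> 's) \<Rightarrow> nat" where
  "ncycles S f = card ((\<lambda>x. {(f ^^ n) x | n. True}) ` S)"

end

theory Submission
  imports Defs
begin

text \<open>
  With \<open>a = s1\<close> and the involution \<open>t = s1 s2\<close> every entry of every tuple is a word in \<open>a\<close>, \<open>t\<close>.
  All required identities between conjugated tuples already hold in the free product
  \<open>\<langle>a\<rangle> * \<langle>t | t\<^sup>2\<rangle>\<close>, so once a conjugating word is given, reduction to normal form
  proves them. The six classes are separated by the pattern of equal entries, which is a
  conjugation invariant; trivial centre enters only through \<open>s1 s2 \<noteq> s2 s1\<close>.
  The permutation group on the six classes is the rotation group of the cube acting on its
  faces (opposite faces being 12, 34, 56). Rotations permute the four diagonals as \<open>S\<^sub>4\<close>,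
  and a face corresponds to the 4-cycle of diagonals given by the quarter turn about it, so
  the isomorphism with \<open>S\<^sub>4\<close> is its conjugation action on the six 4-cycles.
\<close>

section \<open>Rotations of the cube\<close>

text \<open>Indices 1 and 2, 3 and 4, 5 and 6 carry mutually inverse 4-cycles, as quarter turns
  about opposite faces are inverse to each other. The last branch also catches indices outside 1 to
  6, so injectivity holds on \<open>{1..6}\<close> only.\<close>

definition face :: "nat \<Rightarrow> nat \<Rightarrow> nat" where
  "face i = cycle_of_list
    (if i = 1 then [1, 2, 3, 4] else if i = 2 then [1, 4, 3, 2]
     else if i = 3 then [1, 2, 4, 3] else if i = 4 then [1, 3, 4, 2]
     else if i = 5 then [1, 3, 2, 4] else [1, 4, 2, 3])"

text \<open>Conjugation of the 4-cycles by \<open>p\<close>, written without an inverse so that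
  concrete instances can be checked by evaluation. The condition
  \<open>\<pi> permutes {1..6}\<close> pins \<pi> down off the six indices.\<close>

definition intertwines :: "(nat \<Rightarrow> nat) \<Rightarrow> (nat \<Rightarrow> nat) \<Rightarrow> bool" where
  "intertwines p \<pi> \<longleftrightarrow> \<pi> permutes {1..6} \<and> (\<forall>i\<in>{1..6}. p \<circ> face i = face (\<pi> i) \<circ> p)"

definition face_perm :: "(nat \<Rightarrow> nat) \<Rightarrow> nat \<Rightarrow> nat" where
  "face_perm p = (THE \<pi>. intertwines p \<pi>)"

lemma atLeastAtMost_1_6: "{1..6} = {1, 2, 3, 4, 5, 6::nat}"
  by auto

lemma atLeastAtMost_1_4: "{1..4} = {1, 2, 3, 4::nat}"
  by auto

lemma cycle_of_list_permutes:
  "set cs \<subseteq> {1..n} \<Longrightarrow> cycle_of_list cs permutes {1..n::nat}"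
  by (rule permutes_subset[OF cycle_permutes])

lemma face_simps:
  "face 1 1 = 2" "face 1 2 = 3" "face 2 1 = 4" "face 2 2 = 1" "face 3 1 = 2" "face 3 2 = 4"
  "face 4 1 = 3" "face 4 2 = 1" "face 5 1 = 3" "face 5 2 = 4" "face 6 1 = 4" "face 6 2 = 3"
  by (simp_all add: face_def transpose_def)

lemma face_inj_on: "inj_on face {1..6}"
proof -
  \<comment> \<open>The images of 1 and 2 already tell the six 4-cycles apart.\<close>
  have "inj_on (\<lambda>i. (face i 1, face i 2)) {1..6}"
    unfolding atLeastAtMost_1_6 inj_on_insert by (simp add: face_simps del: One_nat_def)
  then show ?thesis by (auto simp: inj_on_def)
qed

text \<open>A surjective \<open>p\<close> cancels on the right of both equations, and a 4-cycle
  determines its index.\<close>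

lemma intertwines_unique:
  assumes "intertwines p \<pi>" "intertwines p \<pi>'" "surj p"
  shows "\<pi> = \<pi>'"
proof
  fix i
  show "\<pi> i = \<pi>' i"
  proof (cases "i \<in> {1..6}")
    case True
    with assms have "face (\<pi> i) \<circ> p = face (\<pi>' i) \<circ> p"
      unfolding intertwines_def by metis
    with \<open>surj p\<close> have "face (\<pi> i) = face (\<pi>' i)"
      by (metis surj_fun_eq)
    moreover have "\<pi> i \<in> {1..6}" "\<pi>' i \<in> {1..6}"
      using assms(1,2) True permutes_in_image unfolding intertwines_def by metis+
    ultimately show ?thesis using face_inj_on by (auto dest: inj_onD)
  next
    case False
    with assms(1,2) show ?thesis by (metis intertwines_def permutes_not_in)
  qed
qed

lemma intertwines_comp:
  assumes "intertwines p \<pi>" "intertwines q \<tau>"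
  shows "intertwines (p \<circ> q) (\<pi> \<circ> \<tau>)"
proof -
  have "(p \<circ> q) \<circ> face i = face (\<pi> (\<tau> i)) \<circ> (p \<circ> q)" if "i \<in> {1..6}" for i
  proof -
    have "\<tau> i \<in> {1..6}"
      using assms(2) that permutes_in_image unfolding intertwines_def by metis
    with assms that have "q \<circ> face i = face (\<tau> i) \<circ> q" "p \<circ> face (\<tau> i) = face (\<pi> (\<tau> i)) \<circ> p"
      unfolding intertwines_def by blast+
    then show ?thesis by (metis comp_assoc)
  qed
  moreover have "(\<pi> \<circ> \<tau>) permutes {1..6}"
    using assms permutes_compose unfolding intertwines_def by blast
  ultimately show ?thesis by (simp add: intertwines_def)
qed

text \<open>The face permutations are those induced by \<open>br3\<close>, \<open>eta23\<close> and
  \<open>eta234\<close>. On the diagonals they come from a quarter turn, a half turn about an axis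
  through opposite edges, and a third turn about a diagonal.\<close>

lemma intertwines_generators:
  "intertwines (cycle_of_list [1, 4, 2, 3]) (cycle_of_list [1, 3, 2, 4])"
  "intertwines (cycle_of_list [1, 2])
     (cycle_of_list [1, 4] \<circ> cycle_of_list [2, 3] \<circ> cycle_of_list [5, 6])"
  "intertwines (cycle_of_list [2, 4, 3]) (cycle_of_list [1, 6, 4] \<circ> cycle_of_list [2, 5, 3])"
proof -
  have ext4: "f = g" if "f 1 = g 1" "f 2 = g 2" "f 3 = g 3" "f 4 = g 4"
    "\<And>x. x \<noteq> 1 \<Longrightarrow> x \<noteq> 2 \<Longrightarrow> x \<noteq> 3 \<Longrightarrow> x \<noteq> 4 \<Longrightarrow> f x = g x" for f g :: "nat \<Rightarrow> nat"
    using that by (metis ext)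
  have cases6: "\<forall>i\<in>{1..6}. Q i" if "Q 1" "Q 2" "Q 3" "Q 4" "Q 5" "Q 6" for Q :: "nat \<Rightarrow> bool"
    using that unfolding atLeastAtMost_1_6 by blast
  show "intertwines (cycle_of_list [1, 4, 2, 3]) (cycle_of_list [1, 3, 2, 4])"
    unfolding intertwines_def
    by (intro conjI cycle_of_list_permutes cases6 ext4; simp add: face_def transpose_def)
  show "intertwines (cycle_of_list [1, 2])
     (cycle_of_list [1, 4] \<circ> cycle_of_list [2, 3] \<circ> cycle_of_list [5, 6])"
    unfolding intertwines_def
    by (intro conjI permutes_compose cycle_of_list_permutes cases6 ext4; simp add: face_def transpose_def)
  show "intertwines (cycle_of_list [2, 4, 3]) (cycle_of_list [1, 6, 4] \<circ> cycle_of_list [2, 5, 3])"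
    unfolding intertwines_def
    by (intro conjI permutes_compose cycle_of_list_permutes cases6 ext4; simp add: face_def transpose_def)
qed

text \<open>Conjugates of \<open>transpose 1 2\<close> by the 3-cycle give all
  \<open>transpose 1 a\<close>, these give every transposition, and transpositions build every
  permutation. Closure under composition suffices because inverses in a finite group are
  powers.\<close>

lemma sym4_induct [consumes 1, case_names id four two three comp]:
  assumes "p permutes {1..4::nat}" "P id" "P (cycle_of_list [1, 4, 2, 3])"
    "P (cycle_of_list [1, 2])" "P (cycle_of_list [2, 4, 3])"
    and comp: "\<And>p q. P p \<Longrightarrow> P q \<Longrightarrow> P (p \<circ> q)"
  shows "P p"
proof -
  let ?h = "cycle_of_list [2, 4, 3::nat]"
  have 12: "P (transpose 1 2)" using assms(4) by simp
  \<comment> \<open>\<open>?h \<circ> ?h\<close> is the inverse of the 3-cycle \<open>?h\<close>, so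
    both words are conjugates of \<open>transpose 1 2\<close>.\<close>
  have "P (?h \<circ> (transpose 1 2 \<circ> (?h \<circ> ?h)))" "P (?h \<circ> (?h \<circ> (transpose 1 2 \<circ> ?h)))"
    by (intro comp 12 assms)+
  moreover have "?h \<circ> (transpose 1 2 \<circ> (?h \<circ> ?h)) = transpose 1 4"
    "?h \<circ> (?h \<circ> (transpose 1 2 \<circ> ?h)) = transpose 1 3"
    by (simp_all add: fun_eq_iff transpose_def)
  ultimately have 14: "P (transpose 1 4)" and 13: "P (transpose 1 3)"
    by simp_all
  \<comment> \<open>The case \<open>a = 1\<close> is the identity.\<close>
  have one: "P (transpose 1 a)" if "a \<in> {1..4}" for a
    using that 12 13 14 \<open>P id\<close> unfolding atLeastAtMost_1_4 by auto
  have "P (transpose a b)" if "a \<in> {1..4}" "b \<in> {1..4}" "a \<noteq> b" for a b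
  proof (cases "a = 1 \<or> b = 1")
    case True
    then show ?thesis using one that by (metis transpose_commute)
  next
    case False
    have "P (transpose 1 a \<circ> (transpose 1 b \<circ> transpose 1 a))"
      by (intro comp one that)
    moreover have "transpose 1 a \<circ> (transpose 1 b \<circ> transpose 1 a) = transpose a b"
      using False \<open>a \<noteq> b\<close> by (auto simp: fun_eq_iff transpose_def)
    ultimately show ?thesis by simp
  qed
  with assms(1) finite_atLeastAtMost show ?thesis
  proof (induction rule: permutes_induct)
    case id
    show ?case by (rule \<open>P id\<close>)
  next
    case (swap a b p)
    show ?case by (intro comp swap.prems swap.IH) (use swap in blast)+
  qed
qed

lemma intertwines_id: "intertwines id id"
  by (simp add: intertwines_def)

lemma intertwines_ex: "p permutes {1..4} \<Longrightarrow> \<exists>\<pi>. intertwines p \<pi>"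
proof (induction rule: sym4_induct)
  case (comp p q)
  then show ?case using intertwines_comp by blast
qed (rule exI, rule intertwines_id intertwines_generators)+

lemma face_perm_eq:
  assumes "intertwines p \<pi>" "p permutes {1..4}"
  shows "face_perm p = \<pi>"
  unfolding face_perm_def
proof (rule the_equality)
  show "\<pi>' = \<pi>" if "intertwines p \<pi>'" for \<pi>'
    using intertwines_unique[OF that assms(1) permutes_surj[OF assms(2)]] .
qed (rule assms)

lemma intertwines_face_perm:
  assumes "p permutes {1..4}"
  shows "intertwines p (face_perm p)"
proof -
  from intertwines_ex[OF assms] obtain \<pi> where "intertwines p \<pi>" ..
  with face_perm_eq[OF this assms] show ?thesis by simp
qed

text \<open>This gives the trivial kernel of \<open>face_perm\<close>. A permutation commuting with
  the 4-cycles is determined by its value at 1, and the two expressions for \<open>p 2\<close> agree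
  only if \<open>p 1 = 1\<close>, since \<open>face 1\<close> and \<open>face 3\<close> coincide at
  no other point of \<open>{1..4}\<close>.\<close>

lemma intertwines_id_imp:
  assumes "intertwines p id" "p permutes {1..4}"
  shows "p = id"
proof -
  have c: "p (face i x) = face i (p x)" if "i \<in> {1..6}" for i x
    using assms(1) that by (metis intertwines_def comp_apply id_apply)
  have p: "p 2 = face 1 (p 1)" "p 3 = face 5 (p 1)" "p 4 = face 2 (p 1)" "p 2 = face 3 (p 1)"
    using c[of 1 1] c[of 5 1] c[of 2 1] c[of 3 1] by (simp_all add: face_simps del: One_nat_def)
  have "p 1 \<in> {1..4}" using permutes_in_image[OF assms(2), of 1] by simp
  then have "p 1 = 1 \<or> p 1 = 2 \<or> p 1 = 3 \<or> p 1 = 4" by auto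
  moreover have "face 1 2 \<noteq> face 3 2" "face 1 3 \<noteq> face 3 3" "face 1 4 \<noteq> face 3 4"
    "face 1 1 = 2" "face 5 1 = 3" "face 2 1 = 4"
    by (simp_all add: face_def transpose_def)
  ultimately have "p 1 = 1 \<and> p 2 = 2 \<and> p 3 = 3 \<and> p 4 = 4"
    using p by metis
  moreover have "p x = x" if "x \<notin> {1, 2, 3, 4}" for x
    using assms(2) that unfolding atLeastAtMost_1_4 by (rule permutes_not_in)
  ultimately show ?thesis by (metis (no_types, lifting) ext id_apply insertE empty_iff)
qed

interpretation sym4: group "sym_group 4" by (rule sym_group_is_group)
interpretation sym6: group "sym_group 6" by (rule sym_group_is_group)

interpretation face: group_hom "sym_group 4" "sym_group 6" face_perm
proof
  show "face_perm \<in> hom (sym_group 4) (sym_group 6)"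
  proof (rule homI)
    fix p q assume "p \<in> carrier (sym_group 4)" "q \<in> carrier (sym_group 4)"
    then have *: "p permutes {1..4}" "q permutes {1..4}" by (simp_all add: sym_group_carrier)
    show "face_perm p \<in> carrier (sym_group 6)"
      using intertwines_face_perm[OF *(1)] by (simp add: intertwines_def sym_group_carrier)
    show "face_perm (p \<otimes>\<^bsub>sym_group 4\<^esub> q) = face_perm p \<otimes>\<^bsub>sym_group 6\<^esub> face_perm q"
      unfolding sym_group_mult
      by (intro face_perm_eq intertwines_comp intertwines_face_perm permutes_compose *)
  qed
qed

lemma face_perm_inj: "inj_on face_perm (carrier (sym_group 4))"
  unfolding face.inj_on_one_iff
proof (intro allI impI)
  fix p assume "p \<in> carrier (sym_group 4)" "face_perm p = \<one>\<^bsub>sym_group 6\<^esub>"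
  then show "p = \<one>\<^bsub>sym_group 4\<^esub>"
    using intertwines_id_imp[of p] intertwines_face_perm[of p]
    by (simp add: sym_group_one sym_group_carrier)
qed

text \<open>Allowing any \<open>B\<close> between \<open>T\<close> and the group it generates covers
  both the full symmetrised braid group and its subgroup from \<open>T\<close>. The group is the
  image of the injective homomorphism \<open>face_perm\<close>, which sends the generators
  \<open>?A\<close> of the symmetric group onto \<open>T\<close>.\<close>

lemma subgroup_generated_octahedral:
  assumes "T = {cycle_of_list [1, 3, 2, 4],
      cycle_of_list [1, 4] \<circ> cycle_of_list [2, 3] \<circ> cycle_of_list [5, 6],
      cycle_of_list [1, 6, 4] \<circ> cycle_of_list [2, 5, 3]}"
    and "T \<subseteq> B" and "B \<subseteq> generate (sym_group 6) T"
  shows "subgroup_generated (sym_group 6) B \<cong> sym_group 4"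
proof -
  let ?A = "{cycle_of_list [1, 4, 2, 3], cycle_of_list [1, 2], cycle_of_list [2, 4, 3::nat]}"
  have A: "?A \<subseteq> carrier (sym_group 4)"
    by (simp add: sym_group_carrier cycle_of_list_permutes del: cycle_of_list.simps One_nat_def)
  have "p \<in> generate (sym_group 4) ?A" if "p permutes {1..4}" for p
    using that
  proof (induction rule: sym4_induct)
    case id
    show ?case using generate.one[of "sym_group 4"] unfolding sym_group_one .
  next
    case (comp p q)
    show ?case using generate.eng[OF comp.IH] unfolding sym_group_mult .
  qed (auto intro: generate.incl)
  then have gA: "generate (sym_group 4) ?A = carrier (sym_group 4)"
    using sym4.generate_incl[OF A] by (auto simp: sym_group_carrier)
  have "face_perm ` ?A = T"
    using A face_perm_eq[OF intertwines_generators(1)] face_perm_eq[OF intertwines_generators(2)]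
      face_perm_eq[OF intertwines_generators(3)]
    unfolding assms(1) by (simp add: sym_group_carrier del: cycle_of_list.simps)
  then have img: "generate (sym_group 6) T = face_perm ` carrier (sym_group 4)"
    using face.generate_img[OF A] gA by simp
  have T: "T \<subseteq> carrier (sym_group 6)"
    using \<open>face_perm ` ?A = T\<close> A face.hom_closed by blast
  \<comment> \<open>\<open>subgroup_generated\<close> intersects its generators with the carrier;
    this inclusion removes the intersection.\<close>
  have B: "B \<subseteq> carrier (sym_group 6)"
    using assms(3) sym6.generate_incl[OF T] by blast
  have "generate (sym_group 6) B = generate (sym_group 6) T"
    using sym6.generate_subgroup_incl[OF assms(3) sym6.generate_is_subgroup[OF T]]
      sym6.mono_generate[OF assms(2)] by blast
  then have car: "carrier (subgroup_generated (sym_group 6) B) = face_perm ` carrier (sym_group 4)"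
    using B img by (simp add: subgroup_generated_def Int_absorb1)
  have "face_perm \<in> iso (sym_group 4) (subgroup_generated (sym_group 6) B)"
    using face_perm_inj face.homh car
    by (auto simp: iso_def hom_def bij_betw_def)
  then show ?thesis
    using sym4.iso_sym is_isoI by blast
qed

section \<open>The Klein four-group of half turns about the face axes\<close>

lemma ext_1_6:
  fixes f g :: "nat \<Rightarrow> 'a"
  assumes "f 1 = g 1" "f 2 = g 2" "f 3 = g 3" "f 4 = g 4" "f 5 = g 5" "f 6 = g 6"
    and "\<And>x. x \<noteq> 1 \<Longrightarrow> x \<noteq> 2 \<Longrightarrow> x \<noteq> 3 \<Longrightarrow> x \<noteq> 4 \<Longrightarrow> x \<noteq> 5 \<Longrightarrow> x \<noteq> 6 \<Longrightarrow> f x = g x"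
  shows "f = g"
  using assms by (metis ext)

text \<open>Each of the three half turns is an involution, the product of two distinct ones is the
  third, and all are even as products of two transpositions.\<close>

lemma klein_four:
  defines "a \<equiv> cycle_of_list [3, 4] \<circ> cycle_of_list [5, 6::nat]"
    and "b \<equiv> cycle_of_list [1, 2] \<circ> cycle_of_list [5, 6::nat]"
    and "c \<equiv> cycle_of_list [1, 2] \<circ> cycle_of_list [3, 4::nat]"
  shows "subgroup_generated (sym_group 6) {a, b, c}
      \<cong> integer_mod_group 2 \<times>\<times> integer_mod_group 2" (is "?H \<cong> ?K")
    and "carrier (subgroup_generated (sym_group 6) {a, b, c}) \<subseteq> carrier (alt_group 6)"
proof -
  have perm: "a permutes {1..6}" "b permutes {1..6}" "c permutes {1..6}"
    unfolding a_def b_def c_def by (intro permutes_compose cycle_of_list_permutes; simp)+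
  have mult: "a \<circ> a = id" "b \<circ> b = id" "c \<circ> c = id" "a \<circ> b = c" "b \<circ> a = c" "a \<circ> c = b"
    "c \<circ> a = b" "b \<circ> c = a" "c \<circ> b = a"
    unfolding a_def b_def c_def
    by (rule ext_1_6; simp add: transpose_def)+
  \<comment> \<open>The values at 1 and 3 record whether 1, 2 and whether 3, 4 are swapped; this
    separates the four elements.\<close>
  have "a 1 = 1" "b 1 = 2" "c 1 = 2" "a 3 = 4" "b 3 = 3" "c 3 = 4"
    by (simp_all add: a_def b_def c_def transpose_def)
  moreover have "p \<noteq> q" if "(p 1, p 3) \<noteq> (q 1, q 3)" for p q :: "nat \<Rightarrow> nat"
    using that by blast
  ultimately have ne: "a \<noteq> id" "b \<noteq> id" "c \<noteq> id" "a \<noteq> b" "a \<noteq> c" "b \<noteq> c"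
    by (simp_all del: One_nat_def)
  have sub: "{a, b, c} \<subseteq> carrier (sym_group 6)"
    using perm by (simp add: sym_group_carrier)
  have V: "subgroup {id, a, b, c} (sym_group 6)"
  proof (rule sym6.subgroupI)
    show "{id, a, b, c} \<subseteq> carrier (sym_group 6)"
      using perm by (simp add: sym_group_carrier permutes_id)
    fix p assume p: "p \<in> {id, a, b, c}"
    then have "p \<circ> p = id" "p permutes {1..6}" using mult perm by (auto simp: permutes_id)
    then have "inv\<^bsub>sym_group 6\<^esub> p = p"
      by (intro sym6.inv_equality) (simp_all add: sym_group_carrier sym_group_mult sym_group_one)
    with p show "inv\<^bsub>sym_group 6\<^esub> p \<in> {id, a, b, c}" by simp
    fix q assume "q \<in> {id, a, b, c}"
    with p show "p \<otimes>\<^bsub>sym_group 6\<^esub> q \<in> {id, a, b, c}"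
      using mult by (auto simp: sym_group_mult)
  qed simp
  have "generate (sym_group 6) {a, b, c} = {id, a, b, c}"
  proof
    show "generate (sym_group 6) {a, b, c} \<subseteq> {id, a, b, c}"
      by (rule sym6.generate_subgroup_incl[OF _ V]) auto
    show "{id, a, b, c} \<subseteq> generate (sym_group 6) {a, b, c}"
      using generate.one[of "sym_group 6" "{a, b, c}"] generate.incl[of _ "{a, b, c}" "sym_group 6"]
      by (simp add: sym_group_one)
  qed
  then have car: "carrier ?H = {id, a, b, c}"
    using sub by (simp add: subgroup_generated_def Int_absorb1)
  have "evenperm a" "evenperm b" "evenperm c"
    unfolding a_def b_def c_def by (simp_all add: evenperm_comp evenperm_swap permutation_swap_id)
  with perm car show "carrier ?H \<subseteq> carrier (alt_group 6)"
    by (simp add: alt_group_carrier permutes_id)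
  \<comment> \<open>The first coordinate says whether 1 and 2 are swapped, the second whether 3 and
    4 are.\<close>
  define f where "f = (\<lambda>(x::int, y::int). if x = 0 then if y = 0 then id else a
    else if y = 0 then b else c)"
  have K: "carrier ?K = {(0, 0), (0, 1), (1, 0), (1, 1)}"
    by (auto simp: carrier_integer_mod_group)
  have "f \<in> iso ?K ?H"
  proof (rule isoI)
    show "f \<in> hom ?K ?H"
    proof (rule homI)
      fix x y assume "x \<in> carrier ?K" "y \<in> carrier ?K"
      then show "f (x \<otimes>\<^bsub>?K\<^esub> y) = f x \<otimes>\<^bsub>?H\<^esub> f y"
        unfolding K using mult by (auto simp: f_def sym_group_mult)
    qed (auto simp: K car f_def)
    show "bij_betw f (carrier ?K) (carrier ?H)"
      unfolding K car bij_betw_def using ne by (auto simp: f_def)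
  qed
  then show "?H \<cong> ?K"
    by (rule group.iso_sym[OF DirProd_group[OF group_integer_mod_group group_integer_mod_group]
          is_isoI])
qed

text \<open>This puts the images of the pure braids into the group generated by the image of
  \<open>T\<close>: the square of a quarter turn is a half turn, and the third turn permutes the
  three face axes.\<close>

lemma double_transpositions_in_octahedral:
  fixes T :: "(nat \<Rightarrow> nat) set"
  assumes "cycle_of_list [1, 3, 2, 4] \<in> T"
    and "cycle_of_list [1, 6, 4] \<circ> cycle_of_list [2, 5, 3] \<in> T"
  shows "cycle_of_list [3, 4] \<circ> cycle_of_list [5, 6] \<in> generate (sym_group 6) T"
    and "cycle_of_list [1, 2] \<circ> cycle_of_list [5, 6] \<in> generate (sym_group 6) T"
    and "cycle_of_list [1, 2] \<circ> cycle_of_list [3, 4] \<in> generate (sym_group 6) T"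
proof -
  let ?r = "cycle_of_list [1, 3, 2, 4::nat]"
  let ?h = "cycle_of_list [1, 6, 4] \<circ> cycle_of_list [2, 5, 3::nat]"
  have comp: "p \<circ> q \<in> generate (sym_group 6) T"
    if "p \<in> generate (sym_group 6) T" "q \<in> generate (sym_group 6) T" for p q
    using generate.eng[OF that] by (simp add: sym_group_mult)
  note incl = assms[THEN generate.incl, of "sym_group 6"]
  \<comment> \<open>As \<open>?h\<close> has order 3, \<open>?h \<circ> ?h\<close> is its inverse
    and the last two words are conjugates of \<open>?r \<circ> ?r\<close>.\<close>
  have "?r \<circ> ?r \<in> generate (sym_group 6) T"
    "?h \<circ> ((?r \<circ> ?r) \<circ> (?h \<circ> ?h)) \<in> generate (sym_group 6) T"
    "(?h \<circ> ?h) \<circ> ((?r \<circ> ?r) \<circ> ?h) \<in> generate (sym_group 6) T"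
    by (intro comp incl)+
  moreover have "?r \<circ> ?r = cycle_of_list [1, 2] \<circ> cycle_of_list [3, 4]"
    "(?h \<circ> ?h) \<circ> ((?r \<circ> ?r) \<circ> ?h) = cycle_of_list [3, 4] \<circ> cycle_of_list [5, 6]"
    "?h \<circ> ((?r \<circ> ?r) \<circ> (?h \<circ> ?h)) = cycle_of_list [1, 2] \<circ> cycle_of_list [5, 6]"
    by (rule ext_1_6; simp add: transpose_def)+
  ultimately show "cycle_of_list [3, 4] \<circ> cycle_of_list [5, 6] \<in> generate (sym_group 6) T"
    "cycle_of_list [1, 2] \<circ> cycle_of_list [5, 6] \<in> generate (sym_group 6) T"
    "cycle_of_list [1, 2] \<circ> cycle_of_list [3, 4] \<in> generate (sym_group 6) T"
    by metis+
qed

section \<open>Counting cycles\<close>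

lemma ncycles_image:
  assumes "inj_on e I" "\<And>i. i \<in> I \<Longrightarrow> \<pi> i \<in> I" "\<And>i. i \<in> I \<Longrightarrow> f (e i) = e (\<pi> i)"
  shows "ncycles (e ` I) f = ncycles I \<pi>"
proof -
  have pow: "(\<pi> ^^ n) i \<in> I \<and> (f ^^ n) (e i) = e ((\<pi> ^^ n) i)" if "i \<in> I" for n i
    using that by (induction n) (auto simp: assms)
  have "{(f ^^ n) (e i) |n. True} = e ` {(\<pi> ^^ n) i |n. True}" if "i \<in> I" for i
    using pow[OF that] by auto
  then have "(\<lambda>x. {(f ^^ n) x |n. True}) ` e ` I = image e ` (\<lambda>x. {(\<pi> ^^ n) x |n. True}) ` I"
    by (simp add: image_image)
  moreover have "(\<lambda>x. {(\<pi> ^^ n) x |n. True}) ` I \<subseteq> Pow I"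
    using pow by auto
  \<comment> \<open>Cycles are subsets of \<open>I\<close>, where \<open>e\<close> is injective, so
    distinct cycles keep distinct images.\<close>
  then have "inj_on (image e) ((\<lambda>x. {(\<pi> ^^ n) x |n. True}) ` I)"
    using inj_on_image_Pow[OF assms(1)] inj_on_subset by blast
  ultimately show ?thesis
    by (simp add: ncycles_def card_image)
qed

text \<open>Here \<open>k\<close> may be any positive multiple of the period, so one exponent serves
  all cycles of a permutation.\<close>

lemma funpow_orbit:
  assumes "(f ^^ k) x = x" "k > 0"
  shows "{(f ^^ n) x |n. True} = (\<lambda>n. (f ^^ n) x) ` {..<k}"
proof -
  have "(f ^^ n) x \<in> (\<lambda>n. (f ^^ n) x) ` {..<k}" for n
    using funpow_mod_eq[OF assms(1), of n] assms(2) by (metis imageI lessThan_iff mod_less_divisor)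
  then show ?thesis by auto
qed

lemma ncycles_generators:
  "ncycles {1..6::nat} (cycle_of_list [1, 3, 2, 4]) = 3"
  "ncycles {1..6::nat} (cycle_of_list [1, 4] \<circ> cycle_of_list [2, 3] \<circ> cycle_of_list [5, 6]) = 3"
  "ncycles {1..6::nat} (cycle_of_list [1, 6, 4] \<circ> cycle_of_list [2, 5, 3]) = 2"
proof -
  \<comment> \<open>Exponent 4 handles cycles of length 1, 2 and 4, hence both \<open>r\<close> and
    \<open>s\<close> below.\<close>
  have orbit4: "{(f ^^ n) x |n. True} = {x, f x, f (f x), f (f (f x))}" if "f (f (f (f x))) = x"
    for f :: "nat \<Rightarrow> nat" and x
    using funpow_orbit[of 4 f x] that by (auto simp: eval_nat_numeral lessThan_Suc)
  have orbit3: "{(f ^^ n) x |n. True} = {x, f x, f (f x)}" if "f (f (f x)) = x"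
    for f :: "nat \<Rightarrow> nat" and x
    using funpow_orbit[of 3 f x] that by (auto simp: eval_nat_numeral lessThan_Suc)
  define r where "r = cycle_of_list [1, 3, 2, 4::nat]"
  have r: "r 1 = 3" "r 2 = 4" "r 3 = 2" "r 4 = 1" "r 5 = 5" "r 6 = 6"
    by (simp_all add: r_def transpose_def)
  have "(\<lambda>x. {(r ^^ n) x |n. True}) ` {1..6} = (\<lambda>x. {x, r x, r (r x), r (r (r x))}) ` {1..6}"
    by (intro image_cong orbit4 refl) (auto simp: atLeastAtMost_1_6 r simp del: One_nat_def)
  also have "\<dots> = {{1, 2, 3, 4}, {5}, {6}}"
    unfolding atLeastAtMost_1_6 by (simp add: r insert_commute del: One_nat_def)
  finally have orb: "(\<lambda>x. {(r ^^ n) x |n. True}) ` {1..6} = {{1, 2, 3, 4}, {5}, {6}}" .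
  have "card {{1, 2, 3, 4}, {5}, {6::nat}} = 3"
    by (simp add: card_insert_if set_eq_subset)
  with orb show "ncycles {1..6::nat} (cycle_of_list [1, 3, 2, 4]) = 3"
    unfolding ncycles_def r_def by simp
  define s where "s = cycle_of_list [1, 4] \<circ> cycle_of_list [2, 3] \<circ> cycle_of_list [5, 6::nat]"
  have s: "s 1 = 4" "s 2 = 3" "s 3 = 2" "s 4 = 1" "s 5 = 6" "s 6 = 5"
    by (simp_all add: s_def transpose_def)
  have "(\<lambda>x. {(s ^^ n) x |n. True}) ` {1..6} = (\<lambda>x. {x, s x, s (s x), s (s (s x))}) ` {1..6}"
    by (intro image_cong orbit4 refl) (auto simp: atLeastAtMost_1_6 s simp del: One_nat_def)
  also have "\<dots> = {{1, 4}, {2, 3}, {5, 6}}"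
    unfolding atLeastAtMost_1_6 by (simp add: s insert_commute del: One_nat_def)
  finally have orb: "(\<lambda>x. {(s ^^ n) x |n. True}) ` {1..6} = {{1, 4}, {2, 3}, {5, 6}}" .
  have "card {{1, 4}, {2, 3}, {5, 6::nat}} = 3"
    by (simp add: card_insert_if set_eq_subset)
  with orb show "ncycles {1..6::nat}
      (cycle_of_list [1, 4] \<circ> cycle_of_list [2, 3] \<circ> cycle_of_list [5, 6]) = 3"
    unfolding ncycles_def s_def by simp
  define h where "h = cycle_of_list [1, 6, 4] \<circ> cycle_of_list [2, 5, 3::nat]"
  have h: "h 1 = 6" "h 2 = 5" "h 3 = 2" "h 4 = 1" "h 5 = 3" "h 6 = 4"
    by (simp_all add: h_def transpose_def)
  have "(\<lambda>x. {(h ^^ n) x |n. True}) ` {1..6} = (\<lambda>x. {x, h x, h (h x)}) ` {1..6}"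
    by (intro image_cong orbit3 refl) (auto simp: atLeastAtMost_1_6 h simp del: One_nat_def)
  also have "\<dots> = {{1, 4, 6}, {2, 3, 5}}"
    unfolding atLeastAtMost_1_6 by (simp add: h insert_commute del: One_nat_def)
  finally have orb: "(\<lambda>x. {(h ^^ n) x |n. True}) ` {1..6} = {{1, 4, 6}, {2, 3, 5}}" .
  have "card {{1, 4, 6}, {2, 3, 5::nat}} = 2"
    by (simp add: card_insert_if set_eq_subset)
  with orb show "ncycles {1..6::nat} (cycle_of_list [1, 6, 4] \<circ> cycle_of_list [2, 5, 3]) = 2"
    unfolding ncycles_def h_def by simp
qed

section \<open>Orbits and induced permutations\<close>

text \<open>The orbit stays in \<open>Z\<close> because the setwise stabiliser of \<open>Z\<close>
  is a subgroup containing the generators; it exhausts \<open>Z\<close> by \<open>reach\<close>,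
  applied to the orbit itself. Closure in \<open>reach\<close> is asked only at points of
  \<open>Z\<close>, which lie in \<open>S\<close>, where \<open>restrict f S\<close> agrees with
  \<open>f\<close>.\<close>

lemma perm_orbit_eqI:
  assumes bij: "\<And>f. f \<in> F \<Longrightarrow> bij_betw f S S"
    and Z: "Z \<subseteq> S" "finite Z" "\<And>f z. f \<in> F \<Longrightarrow> z \<in> Z \<Longrightarrow> f z \<in> Z"
    and "x \<in> Z"
    and reach: "\<And>Y. x \<in> Y \<Longrightarrow> (\<And>f y. f \<in> F \<Longrightarrow> y \<in> Y \<Longrightarrow> y \<in> Z \<Longrightarrow> f y \<in> Y) \<Longrightarrow> Z \<subseteq> Y"
  shows "perm_orbit S F x = Z"
proof -
  interpret B: group "BijGroup S" by (rule group_BijGroup)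
  let ?F = "(\<lambda>f. restrict f S) ` F"
  let ?K = "{p \<in> Bij S. p ` Z = Z}"
  have carB: "carrier (BijGroup S) = Bij S" by (simp add: BijGroup_def)
  have multB: "p \<otimes>\<^bsub>BijGroup S\<^esub> q = compose S p q" if "p \<in> Bij S" "q \<in> Bij S" for p q
    using that by (simp add: BijGroup_def)
  have FB: "?F \<subseteq> Bij S"
    using bij by (auto simp: Bij_def)
  have K: "subgroup ?K (BijGroup S)"
  proof (rule B.subgroupI)
    show "?K \<subseteq> carrier (BijGroup S)" by (auto simp: carB)
    have "(\<lambda>z\<in>S. z) ` Z = Z" using Z(1) by force
    then show "?K \<noteq> {}" using id_Bij by blast
    fix p assume p: "p \<in> ?K"
    then have inj: "inj_on p S" by (auto simp: Bij_def bij_betw_def)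
    have "inv\<^bsub>BijGroup S\<^esub> p = (\<lambda>z\<in>S. inv_into S p z)" using p by (simp add: inv_BijGroup)
    moreover have "(\<lambda>z\<in>S. inv_into S p z) ` Z = inv_into S p ` p ` Z"
      using p Z(1) by (auto intro!: image_cong)
    moreover have "inv_into S p ` p ` Z = Z"
      using inj Z(1) by (rule inv_into_image_cancel)
    ultimately show "inv\<^bsub>BijGroup S\<^esub> p \<in> ?K"
      using p restrict_inv_into_Bij by auto
    fix q assume q: "q \<in> ?K"
    have "compose S p q ` Z = p ` q ` Z"
      using Z(1) by (force simp: compose_def)
    then show "p \<otimes>\<^bsub>BijGroup S\<^esub> q \<in> ?K"
      using p q compose_Bij by (auto simp: multB)
  qed
  have "?F \<subseteq> ?K"
  proof
    fix p assume "p \<in> ?F"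
    then obtain f where f: "f \<in> F" "p = restrict f S" by blast
    have "inj_on f Z" using bij[OF f(1)] Z(1) by (meson bij_betw_def inj_on_subset)
    moreover have "f ` Z \<subseteq> Z" using Z(3)[OF f(1)] by blast
    \<comment> \<open>An injective self-map of a finite set is onto, so invariance of
      \<open>Z\<close> gives equality.\<close>
    ultimately have "f ` Z = Z" using Z(2) by (metis endo_inj_surj)
    moreover have "p ` Z = f ` Z" using Z(1) f(2) by (auto intro!: image_cong)
    ultimately show "p \<in> ?K" using FB \<open>p \<in> ?F\<close> by blast
  qed
  then have le: "generate (BijGroup S) ?F \<subseteq> ?K"
    by (rule B.generate_subgroup_incl[OF _ K])
  then have "perm_orbit S F x \<subseteq> Z"
    using \<open>x \<in> Z\<close> by (fastforce simp: perm_orbit_def)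
  moreover have "Z \<subseteq> perm_orbit S F x"
  proof (rule reach)
    have orbitI: "p x \<in> perm_orbit S F x" if "p \<in> generate (BijGroup S) ?F" for p
      using that unfolding perm_orbit_def by blast
    have "(\<lambda>z\<in>S. z) \<in> generate (BijGroup S) ?F"
      using generate.one[of "BijGroup S" ?F] by (simp add: BijGroup_def)
    from orbitI[OF this] show "x \<in> perm_orbit S F x"
      using \<open>x \<in> Z\<close> Z(1) by auto
    fix f y assume f: "f \<in> F" and y: "y \<in> perm_orbit S F x" "y \<in> Z"
    then obtain p where p: "p \<in> generate (BijGroup S) ?F" "y = p x"
      unfolding perm_orbit_def by blast
    have "restrict f S \<otimes>\<^bsub>BijGroup S\<^esub> p = compose S (restrict f S) p"
      using f p(1) FB le by (intro multB) auto
    then have "compose S (restrict f S) p \<in> generate (BijGroup S) ?F"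
      using generate.eng[OF generate.incl[OF imageI[OF f]] p(1)] by metis
    then have "compose S (restrict f S) p x \<in> perm_orbit S F x" by (rule orbitI)
    moreover have "x \<in> S" "y \<in> S" using \<open>x \<in> Z\<close> y(2) Z(1) by blast+
    ultimately show "f y \<in> perm_orbit S F x"
      using p(2) by (simp add: compose_def)
  qed
  ultimately show ?thesis by blast
qed

lemma rho4_eqI:
  assumes inj: "inj_on e {1..6}" and "\<pi> permutes {1..6}"
    and f: "\<And>i. i \<in> {1..6} \<Longrightarrow> f (e i) = e (\<pi> i)"
  shows "rho4 e f = \<pi>"
proof
  fix i
  show "rho4 e f i = \<pi> i"
  proof (cases "i \<in> {1..6}")
    case True
    then have \<pi>: "\<pi> i \<in> {1..6}" using permutes_in_image[OF assms(2)] by blast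
    have "(THE j. j \<in> {1..6} \<and> f (e i) = e j) = \<pi> i"
    proof (rule the_equality)
      fix j assume "j \<in> {1..6} \<and> f (e i) = e j"
      then have "e j = e (\<pi> i)" "j \<in> {1..6}" using f[OF True] by simp_all
      then show "j = \<pi> i" using inj_onD[OF inj] \<pi> by blast
    qed (rule conjI[OF \<pi> f[OF True]])
    with True show ?thesis by (simp add: rho4_def)
  next
    case False
    with permutes_not_in[OF assms(2) False] show ?thesis unfolding rho4_def by presburger
  qed
qed

section \<open>Braid moves on generating tuples\<close>

fun entries :: "'a tup4 \<Rightarrow> 'a set" where
  "entries (a, b, c, d) = {a, b, c, d}"

fun tprod :: "('a, 'b) monoid_scheme \<Rightarrow> 'a tup4 \<Rightarrow> 'a" where
  "tprod G (a, b, c, d) = a \<otimes>\<^bsub>G\<^esub> b \<otimes>\<^bsub>G\<^esub> c \<otimes>\<^bsub>G\<^esub> d"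

text \<open>The representatives behind \<open>Sigma_i\<close>; braids are first studied as maps on
  these tuples and only then on conjugacy classes.\<close>

definition nielsen :: "('a, 'b) monoid_scheme \<Rightarrow> 'a set \<Rightarrow> 'a tup4 set" where
  "nielsen G C = {t. entries t \<subseteq> C \<and> generate G (entries t) = carrier G \<and> tprod G t = \<one>\<^bsub>G\<^esub>}"

lemma Sigma_i_eq: "Sigma_i G C = tcls G ` nielsen G C"
proof (intro equalityI subsetI)
  fix Y assume "Y \<in> Sigma_i G C"
  then obtain a b c d where "Y = tcls G (a, b, c, d)" "(a, b, c, d) \<in> nielsen G C"
    unfolding Sigma_i_def nielsen_def by auto
  then show "Y \<in> tcls G ` nielsen G C" by blast
next
  fix Y assume "Y \<in> tcls G ` nielsen G C"
  then obtain a b c d where "Y = tcls G (a, b, c, d)" "(a, b, c, d) \<in> nielsen G C"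
    by (metis imageE surj_pair)
  then show "Y \<in> Sigma_i G C"
    unfolding Sigma_i_def nielsen_def by auto
qed

text \<open>The inverse of \<open>eta23\<close>: \<open>x\<close> recovers the old second entry,
  which \<open>eta23\<close> conjugated by the unchanged last entry.\<close>

fun eta23i :: "('a, 'b) monoid_scheme \<Rightarrow> 'a tup4 \<Rightarrow> 'a tup4" where
  "eta23i G (a, b, c, d) =
    (let x = inv\<^bsub>G\<^esub> d \<otimes>\<^bsub>G\<^esub> c \<otimes>\<^bsub>G\<^esub> d in (x \<otimes>\<^bsub>G\<^esub> a \<otimes>\<^bsub>G\<^esub> inv\<^bsub>G\<^esub> x, x, b, d))"

fun eta234i :: "('a, 'b) monoid_scheme \<Rightarrow> 'a tup4 \<Rightarrow> 'a tup4" where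
  "eta234i G (a, b, c, d) =
    (a, d, inv\<^bsub>G\<^esub> d \<otimes>\<^bsub>G\<^esub> b \<otimes>\<^bsub>G\<^esub> d, inv\<^bsub>G\<^esub> d \<otimes>\<^bsub>G\<^esub> c \<otimes>\<^bsub>G\<^esub> d)"

section \<open>Reduction of words and the conjugation action on tuples\<close>

context group
begin

lemma inv_cancel:
  assumes "x \<in> carrier G" "y \<in> carrier G"
  shows "inv x \<otimes> (x \<otimes> y) = y" "x \<otimes> (inv x \<otimes> y) = y"
  using assms by (simp_all flip: m_assoc)

text \<open>Together with the standard group simplification rules, these bring words to
  right-associated, freely reduced form.\<close>

lemmas word_simps = m_assoc inv_mult_group inv_cancel

text \<open>The product is \<open>g \<otimes> h\<close> because conjugation acts from the
  right.\<close>

lemma tconj_tconj: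
  assumes "entries t \<subseteq> carrier G" "g \<in> carrier G" "h \<in> carrier G"
  shows "tconj G h (tconj G g t) = tconj G (g \<otimes> h) t"
  using assms by (cases t) (simp add: word_simps)

lemma tcls_tconj:
  assumes "entries t \<subseteq> carrier G" "g \<in> carrier G"
  shows "tcls G (tconj G g t) = tcls G t"
proof -
  have "tconj G h (tconj G g t) \<in> tcls G t" if "h \<in> carrier G" for h
    using that assms unfolding tcls_def by (auto simp: tconj_tconj)
  moreover have "tconj G h t \<in> tcls G (tconj G g t)" if "h \<in> carrier G" for h
  proof -
    have "tconj G h t = tconj G (inv g \<otimes> h) (tconj G g t)"
      using that assms by (simp add: tconj_tconj inv_cancel)
    then show ?thesis using that assms unfolding tcls_def by blast
  qed
  ultimately show ?thesis unfolding tcls_def by blast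
qed

lemma self_in_tcls: "entries t \<subseteq> carrier G \<Longrightarrow> t \<in> tcls G t"
proof -
  assume "entries t \<subseteq> carrier G"
  then have "tconj G \<one> t = t" by (cases t) simp
  then have "t = tconj G \<one> t" by simp
  then show ?thesis unfolding tcls_def by blast
qed

end

text \<open>Invariance under conjugation is all that the braid moves ask of \<open>C\<close>; the
  class of \<open>s1\<close> enters later as an instance.\<close>

locale conj_invariant_subset = group G for G (structure) +
  fixes C
  assumes C_subset: "C \<subseteq> carrier G"
    and C_conj: "x \<in> C \<Longrightarrow> g \<in> carrier G \<Longrightarrow> inv g \<otimes> x \<otimes> g \<in> C"
begin

lemma C_closed: "x \<in> C \<Longrightarrow> x \<in> carrier G"
  using C_subset by blast

lemma C_conj': "x \<in> C \<Longrightarrow> g \<in> carrier G \<Longrightarrow> g \<otimes> x \<otimes> inv g \<in> C"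
  using C_conj[of x "inv g"] by simp

text \<open>One direction of an invertible move: \<open>f'\<close> is only a left inverse, and the
  entries of \<open>f t\<close> need only lie in the subgroup generated by those of
  \<open>t\<close>. Using the property for \<open>f\<close> and \<open>f'\<close> together yields
  the two-sided statements.\<close>

definition braid_move :: "('a tup4 \<Rightarrow> 'a tup4) \<Rightarrow> ('a tup4 \<Rightarrow> 'a tup4) \<Rightarrow> bool" where
  "braid_move f f' \<longleftrightarrow> (\<forall>t. entries t \<subseteq> C \<longrightarrow> tprod G t = \<one> \<longrightarrow>
     entries (f t) \<subseteq> C \<and> tprod G (f t) = \<one> \<and> entries (f t) \<subseteq> generate G (entries t) \<and>
     f' (f t) = t \<and> (\<forall>g\<in>carrier G. f (tconj G g t) = tconj G g (f t)))"

text \<open>The product relation is offered as rewrite rules on prefixes of words. Its cyclic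
  rotation to c d a b serves \<open>eta23i\<close>, whose new product is a conjugate of that
  rotation. The arbitrary subgroup \<open>H\<close> turns generation into plain closure
  conditions.\<close>

lemma braid_moveI:
  assumes "\<And>a b c d. \<lbrakk>a \<in> C; b \<in> C; c \<in> C; d \<in> C\<rbrakk> \<Longrightarrow> entries (f (a, b, c, d)) \<subseteq> C"
    "\<And>a b c d. \<lbrakk>a \<in> carrier G; b \<in> carrier G; c \<in> carrier G; d \<in> carrier G;
        \<And>x. x \<in> carrier G \<Longrightarrow> a \<otimes> (b \<otimes> (c \<otimes> (d \<otimes> x))) = x;
        \<And>x. x \<in> carrier G \<Longrightarrow> c \<otimes> (d \<otimes> (a \<otimes> (b \<otimes> x))) = x;
        a \<otimes> (b \<otimes> (c \<otimes> d)) = \<one>\<rbrakk> \<Longrightarrow> tprod G (f (a, b, c, d)) = \<one>"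
    "\<And>a b c d H. \<lbrakk>subgroup H G; a \<in> H; b \<in> H; c \<in> H; d \<in> H\<rbrakk> \<Longrightarrow> entries (f (a, b, c, d)) \<subseteq> H"
    "\<And>a b c d. \<lbrakk>a \<in> carrier G; b \<in> carrier G; c \<in> carrier G; d \<in> carrier G\<rbrakk>
       \<Longrightarrow> f' (f (a, b, c, d)) = (a, b, c, d)"
    "\<And>a b c d g. \<lbrakk>a \<in> carrier G; b \<in> carrier G; c \<in> carrier G; d \<in> carrier G; g \<in> carrier G\<rbrakk>
       \<Longrightarrow> f (tconj G g (a, b, c, d)) = tconj G g (f (a, b, c, d))"
  shows "braid_move f f'"
  unfolding braid_move_def
proof (intro allI impI)
  fix t assume t: "entries t \<subseteq> C" "tprod G t = \<one>"
  obtain a b c d where [simp]: "t = (a, b, c, d)" by (cases t)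
  have C: "a \<in> C" "b \<in> C" "c \<in> C" "d \<in> C" using t(1) by auto
  then have G: "a \<in> carrier G" "b \<in> carrier G" "c \<in> carrier G" "d \<in> carrier G"
    by (simp_all add: C_closed)
  have one: "a \<otimes> b \<otimes> c \<otimes> d = \<one>" using t(2) by simp
  then have two: "(a \<otimes> b) \<otimes> (c \<otimes> d) = \<one>" using G by (simp add: m_assoc)
  then have "(c \<otimes> d) \<otimes> (a \<otimes> b) = \<one>" using G by (simp add: inv_comm)
  then have "((c \<otimes> d) \<otimes> (a \<otimes> b)) \<otimes> x = x" "((a \<otimes> b) \<otimes> (c \<otimes> d)) \<otimes> x = x"
    if "x \<in> carrier G" for x
    using two that by simp_all
  then have "c \<otimes> (d \<otimes> (a \<otimes> (b \<otimes> x))) = x" "a \<otimes> (b \<otimes> (c \<otimes> (d \<otimes> x))) = x"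
    if "x \<in> carrier G" for x
    using that G by (simp_all add: m_assoc)
  moreover have "a \<otimes> (b \<otimes> (c \<otimes> d)) = \<one>"
    using one G by (simp add: m_assoc)
  ultimately have "tprod G (f t) = \<one>"
    using assms(2)[OF G] by simp
  moreover have "entries (f t) \<subseteq> generate G (entries t)"
    using assms(3)[of "generate G {a, b, c, d}" a b c d] G
    by (simp add: generate_is_subgroup generate.incl)
  ultimately show "entries (f t) \<subseteq> C \<and> tprod G (f t) = \<one> \<and> entries (f t) \<subseteq> generate G (entries t) \<and>
     f' (f t) = t \<and> (\<forall>g\<in>carrier G. f (tconj G g t) = tconj G g (f t))"
    using assms(1)[OF C] assms(4)[OF G] assms(5)[OF G] by auto
qed

text \<open>Every move occurs along with its inverse, in both orders, since bijectivity uses the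
  property in both directions.\<close>

lemma braid_moves:
  "braid_move (br2 G) (br2i G)" "braid_move (br2i G) (br2 G)" "braid_move (br3 G) (br3i G)" "braid_move (br3i G) (br3 G)"
  "braid_move (br4 G) (br4i G)" "braid_move (br4i G) (br4 G)" "braid_move (eta23 G) (eta23i G)"
  "braid_move (eta23i G) (eta23 G)" "braid_move (eta234 G) (eta234i G)" "braid_move (eta234i G) (eta234 G)"
  by (rule braid_moveI;
      (simp add: Let_def C_conj C_conj' C_closed subgroup.m_closed subgroup.m_inv_closed; fail
       | simp add: Let_def word_simps))+

end

section \<open>Equivariant bijections of tuples and the maps they induce on classes\<close>

context conj_invariant_subset
begin

definition class_bij :: "('a tup4 \<Rightarrow> 'a tup4) \<Rightarrow> bool" where
  "class_bij f \<longleftrightarrow> (\<exists>f'. \<forall>t\<in>nielsen G C.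
     f t \<in> nielsen G C \<and> f' t \<in> nielsen G C \<and> f' (f t) = t \<and> f (f' t) = t \<and>
     (\<forall>g\<in>carrier G. f (tconj G g t) = tconj G g (f t) \<and> f' (tconj G g t) = tconj G g (f' t)))"

text \<open>Generation survives because \<open>t = f' (f t)\<close> has its entries in the subgroup
  generated by the entries of \<open>f t\<close>.\<close>

lemma braid_move_nielsen:
  assumes "braid_move f f'" "braid_move f' f" "t \<in> nielsen G C"
  shows "f t \<in> nielsen G C"
proof -
  have t: "entries t \<subseteq> C" "tprod G t = \<one>" "generate G (entries t) = carrier G"
    using assms(3) by (simp_all add: nielsen_def)
  then have f: "entries (f t) \<subseteq> C" "tprod G (f t) = \<one>" "f' (f t) = t"
    using assms(1) unfolding braid_move_def by blast+
  have "entries (f' (f t)) \<subseteq> generate G (entries (f t))"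
    using assms(2) f(1,2) unfolding braid_move_def by blast
  then have "entries t \<subseteq> generate G (entries (f t))"
    using f(3) by simp
  moreover have ft: "entries (f t) \<subseteq> carrier G" using f(1) C_subset by blast
  ultimately have "generate G (entries t) \<subseteq> generate G (entries (f t))"
    by (intro generate_subgroup_incl generate_is_subgroup)
  with t(3) f(1,2) generate_incl[OF ft] show ?thesis
    by (auto simp: nielsen_def)
qed

lemma class_bij_braid_move:
  assumes "braid_move f f'" "braid_move f' f"
  shows "class_bij f"
  unfolding class_bij_def
proof (intro exI[of _ f'] ballI)
  fix t assume t: "t \<in> nielsen G C"
  then have "entries t \<subseteq> C" "tprod G t = \<one>" by (simp_all add: nielsen_def)
  then have "f' (f t) = t \<and> f (f' t) = t \<and>
     (\<forall>g\<in>carrier G. f (tconj G g t) = tconj G g (f t) \<and> f' (tconj G g t) = tconj G g (f' t))"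
    using assms unfolding braid_move_def by blast
  with braid_move_nielsen[OF assms t] braid_move_nielsen[OF assms(2,1) t]
  show "f t \<in> nielsen G C \<and> f' t \<in> nielsen G C \<and> f' (f t) = t \<and> f (f' t) = t \<and>
     (\<forall>g\<in>carrier G. f (tconj G g t) = tconj G g (f t) \<and> f' (tconj G g t) = tconj G g (f' t))"
    by blast
qed

lemma class_bij_comp:
  assumes "class_bij f" "class_bij h"
  shows "class_bij (f \<circ> h)"
proof -
  from assms(1) obtain f' where f: "\<And>t. t \<in> nielsen G C \<Longrightarrow>
     f t \<in> nielsen G C \<and> f' t \<in> nielsen G C \<and> f' (f t) = t \<and> f (f' t) = t \<and>
     (\<forall>g\<in>carrier G. f (tconj G g t) = tconj G g (f t) \<and> f' (tconj G g t) = tconj G g (f' t))"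
    unfolding class_bij_def by blast
  from assms(2) obtain h' where h: "\<And>t. t \<in> nielsen G C \<Longrightarrow>
     h t \<in> nielsen G C \<and> h' t \<in> nielsen G C \<and> h' (h t) = t \<and> h (h' t) = t \<and>
     (\<forall>g\<in>carrier G. h (tconj G g t) = tconj G g (h t) \<and> h' (tconj G g t) = tconj G g (h' t))"
    unfolding class_bij_def by blast
  show ?thesis
    unfolding class_bij_def by (intro exI[of _ "h' \<circ> f'"] ballI) (simp add: f h)
qed

lemma class_bij_generators:
  "class_bij (br2 G)" "class_bij (br2i G)" "class_bij (br3 G)" "class_bij (br3i G)"
  "class_bij (br4 G)" "class_bij (eta23 G)" "class_bij (eta234 G)"
  "class_bij (b12 G)" "class_bij (b13 G)" "class_bij (b14 G)"
  "class_bij (b23 G)" "class_bij (b24 G)" "class_bij (b34 G)"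
proof -
  show *: "class_bij (br2 G)" "class_bij (br2i G)" "class_bij (br3 G)" "class_bij (br3i G)"
    "class_bij (br4 G)" "class_bij (eta23 G)" "class_bij (eta234 G)"
    by (rule class_bij_braid_move; rule braid_moves)+
  show "class_bij (b12 G)" "class_bij (b13 G)" "class_bij (b14 G)"
    "class_bij (b23 G)" "class_bij (b24 G)" "class_bij (b34 G)"
    unfolding b12_def b13_def b14_def b23_def b24_def b34_def
    by (intro class_bij_comp *)+
qed

text \<open>Equivariance makes the image of a whole conjugacy class again a single class.\<close>

lemma clsmap_tcls:
  assumes "class_bij f" "t \<in> nielsen G C"
  shows "clsmap f (tcls G t) = tcls G (f t)"
proof -
  have "f (tconj G g t) = tconj G g (f t)" if "g \<in> carrier G" for g
    using assms that unfolding class_bij_def by blast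
  then have "f ` {tconj G g t |g. g \<in> carrier G} = {tconj G g (f t) |g. g \<in> carrier G}"
    by (force simp: image_iff)
  then show ?thesis unfolding clsmap_def tcls_def .
qed

lemma clsmap_bij_betw:
  assumes "class_bij f"
  shows "bij_betw (clsmap f) (Sigma_i G C) (Sigma_i G C)"
proof -
  from assms obtain f' where f: "\<And>t. t \<in> nielsen G C \<Longrightarrow>
     f t \<in> nielsen G C \<and> f' t \<in> nielsen G C \<and> f' (f t) = t \<and> f (f' t) = t \<and>
     (\<forall>g\<in>carrier G. f (tconj G g t) = tconj G g (f t) \<and> f' (tconj G g t) = tconj G g (f' t))"
    unfolding class_bij_def by blast
  then have "class_bij f'"
    unfolding class_bij_def by (intro exI[of _ f]) blast
  note cls = clsmap_tcls[OF assms] clsmap_tcls[OF this]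
  show ?thesis
    unfolding Sigma_i_eq
    by (rule bij_betw_byWitness[of _ "clsmap f'"]) (auto simp: cls f)
qed

lemma clsmap_tcls_eqI:
  assumes "class_bij f" "t \<in> nielsen G C" "g \<in> carrier G" "tconj G g (f t) = u"
  shows "clsmap f (tcls G t) = tcls G u"
proof -
  have "f t \<in> nielsen G C" using assms(1,2) unfolding class_bij_def by blast
  then have "entries (f t) \<subseteq> carrier G" using C_subset by (auto simp: nielsen_def)
  with assms show ?thesis by (metis clsmap_tcls tcls_tconj)
qed

end

section \<open>The six classes\<close>

text \<open>A conjugation invariant that separates the six tuples: each of the listed equalities
  holds in exactly one of them, and none holds in the fourth tuple.\<close>

fun coincidences :: "'a tup4 \<Rightarrow> bool list" where
  "coincidences (a, b, c, d) = [a = b, c = d, a = c, b = c, a = d]"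

context group
begin

lemma coincidences_tconj:
  assumes "entries t \<subseteq> carrier G" "g \<in> carrier G"
  shows "coincidences (tconj G g t) = coincidences t"
  using assms by (cases t) (simp add: m_assoc)

lemma conj_eq_iff:
  assumes "x \<in> carrier G" "y \<in> carrier G" "z \<in> carrier G"
  shows "x \<otimes> y \<otimes> inv x = z \<longleftrightarrow> x \<otimes> y = z \<otimes> x" "inv x \<otimes> y \<otimes> x = z \<longleftrightarrow> y \<otimes> x = x \<otimes> z"
proof -
  show "x \<otimes> y \<otimes> inv x = z \<longleftrightarrow> x \<otimes> y = z \<otimes> x"
    using inv_solve_right'[of z "x \<otimes> y" x] assms by auto
  show "inv x \<otimes> y \<otimes> x = z \<longleftrightarrow> y \<otimes> x = x \<otimes> z"
    using inv_solve_left'[of z x "y \<otimes> x"] assms by (auto simp: m_assoc)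
qed

lemma commutes_with_generate:
  assumes "S \<subseteq> carrier G" "x \<in> carrier G" "\<And>s. s \<in> S \<Longrightarrow> x \<otimes> s = s \<otimes> x" "g \<in> generate G S"
  shows "x \<otimes> g = g \<otimes> x"
  using assms(4)
proof (induction rule: generate.induct)
  case one
  then show ?case using assms(2) by simp
next
  case (incl h)
  then show ?case by (rule assms(3))
next
  case (inv h)
  then have h: "h \<in> carrier G" "x \<otimes> h = h \<otimes> x" using assms by auto
  then have "inv h \<otimes> (x \<otimes> h) \<otimes> inv h = inv h \<otimes> (h \<otimes> x) \<otimes> inv h" by simp
  then show ?case using h(1) assms(2) by (simp add: word_simps)
next
  case (eng h1 h2)
  then have "h1 \<in> carrier G" "h2 \<in> carrier G"
    using generate_in_carrier[OF assms(1)] by blast+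
  then show ?case using eng.IH assms(2) by (metis m_assoc)
qed

text \<open>Commuting generators would be central, hence trivial, and so would the group be.\<close>

lemma noncommuting_generators:
  assumes "carrier G \<noteq> {\<one>}" "center G = {\<one>}"
    and s: "s1 \<in> carrier G" "s2 \<in> carrier G" "generate G {s1, s2} = carrier G"
  shows "s1 \<otimes> s2 \<noteq> s2 \<otimes> s1"
proof
  assume comm: "s1 \<otimes> s2 = s2 \<otimes> s1"
  have "s \<in> center G" if "s \<in> {s1, s2}" for s
  proof -
    have "s \<otimes> s' = s' \<otimes> s" if "s' \<in> {s1, s2}" for s'
      using that \<open>s \<in> {s1, s2}\<close> comm by (elim insertE emptyE) simp_all
    then have "s \<otimes> g = g \<otimes> s" if "g \<in> generate G {s1, s2}" for g
      using commutes_with_generate[of "{s1, s2}" s g] that \<open>s \<in> {s1, s2}\<close> s(1,2) by blast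
    then show ?thesis using s that unfolding center_def by blast
  qed
  then have "s1 = \<one>" "s2 = \<one>" using assms(2) by blast+
  then have "carrier G = {\<one>}" using s(3) generate_one by simp
  with assms(1) show False by simp
qed

text \<open>The conjugator may differ from tuple to tuple, so this describes the action on classes
  while speaking of tuples only.\<close>

definition acts_as :: "'a \<Rightarrow> 'a \<Rightarrow> ('a tup4 \<Rightarrow> 'a tup4) \<Rightarrow> (nat \<Rightarrow> nat) \<Rightarrow> bool" where
  "acts_as s1 s2 f \<pi> \<longleftrightarrow>
     (\<forall>i\<in>{1..6}. \<exists>g\<in>carrier G. tconj G g (f (etup G s1 s2 i)) = etup G s1 s2 (\<pi> i))"

lemma acts_asI:
  assumes "g1 \<in> carrier G" "g2 \<in> carrier G" "g3 \<in> carrier G"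
    "g4 \<in> carrier G" "g5 \<in> carrier G" "g6 \<in> carrier G"
    and "tconj G g1 (f (etup G s1 s2 1)) = etup G s1 s2 (\<pi> 1)"
    "tconj G g2 (f (etup G s1 s2 2)) = etup G s1 s2 (\<pi> 2)"
    "tconj G g3 (f (etup G s1 s2 3)) = etup G s1 s2 (\<pi> 3)"
    "tconj G g4 (f (etup G s1 s2 4)) = etup G s1 s2 (\<pi> 4)"
    "tconj G g5 (f (etup G s1 s2 5)) = etup G s1 s2 (\<pi> 5)"
    "tconj G g6 (f (etup G s1 s2 6)) = etup G s1 s2 (\<pi> 6)"
  shows "acts_as s1 s2 f \<pi>"
  unfolding acts_as_def atLeastAtMost_1_6 using assms by blast

text \<open>With \<open>s = inv a \<otimes> t\<close> all entries are words in \<open>a\<close> and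
  the involution \<open>t\<close>. The witnesses in each call are the conjugators for the six tuples
  in order; \<open>inv_t\<close> and \<open>tt\<close> complete the reduction to normal
  form.\<close>

lemma acts_as_table:
  assumes [simp]: "a \<in> carrier G" "t \<in> carrier G" and t: "t \<otimes> t = \<one>" and s: "s = inv a \<otimes> t"
    shows
    "acts_as a s (b12 G) (cycle_of_list [3, 4] \<circ> cycle_of_list [5, 6])"
    "acts_as a s (b13 G) (cycle_of_list [1, 2] \<circ> cycle_of_list [5, 6])"
    "acts_as a s (b14 G) (cycle_of_list [1, 2] \<circ> cycle_of_list [3, 4])"
    "acts_as a s (b23 G) (cycle_of_list [1, 2] \<circ> cycle_of_list [3, 4])"
    "acts_as a s (b24 G) (cycle_of_list [1, 2] \<circ> cycle_of_list [5, 6])"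
    "acts_as a s (b34 G) (cycle_of_list [3, 4] \<circ> cycle_of_list [5, 6])"
    "acts_as a s (br3 G) (cycle_of_list [1, 3, 2, 4])"
    "acts_as a s (eta23 G) (cycle_of_list [1, 4] \<circ> cycle_of_list [2, 3] \<circ> cycle_of_list [5, 6])"
    "acts_as a s (eta234 G) (cycle_of_list [1, 6, 4] \<circ> cycle_of_list [2, 5, 3])"
proof -
  have inv_t: "inv t = t" using t by (simp add: inv_equality)
  have tt: "t \<otimes> (t \<otimes> x) = x" if "x \<in> carrier G" for x
    using that t by (simp flip: m_assoc)
  show "acts_as a s (b12 G) (cycle_of_list [3, 4] \<circ> cycle_of_list [5, 6])"
    \<comment> \<open>\<open>b12\<close> conjugates the first two entries by their product, and
      conjugating by that product undoes this: it is \<open>t\<close> for the last four tuples and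
      \<open>t \<otimes> a \<otimes> t \<otimes> a\<close> for the second. The first tuple is
      unchanged.\<close>
    by (rule acts_asI[of "\<one>" "t \<otimes> a \<otimes> t \<otimes> a" "t" "t" "t" "t"];
        simp add: b12_def transpose_def s word_simps inv_t t tt)
  show "acts_as a s (b13 G) (cycle_of_list [1, 2] \<circ> cycle_of_list [5, 6])"
    by (rule acts_asI[of "a \<otimes> t \<otimes> a" "inv a \<otimes> t \<otimes> inv a" "t \<otimes> a \<otimes> t \<otimes> a" "\<one>" "t \<otimes> a" "inv a \<otimes> t"];
        simp add: b13_def transpose_def s word_simps inv_t t tt)
  show "acts_as a s (b14 G) (cycle_of_list [1, 2] \<circ> cycle_of_list [3, 4])"
    by (rule acts_asI[of "t \<otimes> a" "inv a \<otimes> t" "inv a \<otimes> t" "t \<otimes> a" "t \<otimes> a \<otimes> t \<otimes> a" "\<one>"];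
        simp add: b14_def transpose_def s word_simps inv_t t tt)
  show "acts_as a s (b23 G) (cycle_of_list [1, 2] \<circ> cycle_of_list [3, 4])"
    by (rule acts_asI[of "a" "inv a" "inv a" "a" "\<one>" "inv a \<otimes> inv a"];
        simp add: b23_def transpose_def s word_simps inv_t t tt)
  show "acts_as a s (b24 G) (cycle_of_list [1, 2] \<circ> cycle_of_list [5, 6])"
    by (rule acts_asI[of "\<one>" "\<one>" "inv a \<otimes> inv a" "\<one>" "inv a" "a"];
        simp add: b24_def transpose_def s word_simps inv_t t tt)
  show "acts_as a s (b34 G) (cycle_of_list [3, 4] \<circ> cycle_of_list [5, 6])"
    by (rule acts_asI[of "inv a \<otimes> inv a" "\<one>" "\<one>" "\<one>" "\<one>" "\<one>"];
        simp add: b34_def transpose_def s word_simps inv_t t tt)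
  show "acts_as a s (br3 G) (cycle_of_list [1, 3, 2, 4])"
    by (rule acts_asI[of "a" "inv a" "\<one>" "\<one>" "\<one>" "inv a"];
        simp add: transpose_def s word_simps inv_t t tt)
  show "acts_as a s (eta23 G) (cycle_of_list [1, 4] \<circ> cycle_of_list [2, 3] \<circ> cycle_of_list [5, 6])"
    by (rule acts_asI[of "\<one>" "inv a \<otimes> t \<otimes> inv a \<otimes> t" "t \<otimes> a" "t \<otimes> inv a" "t \<otimes> a" "t"];
        simp add: transpose_def s word_simps inv_t t tt)
  show "acts_as a s (eta234 G) (cycle_of_list [1, 6, 4] \<circ> cycle_of_list [2, 5, 3])"
    by (rule acts_asI[of "a" "inv a" "\<one>" "inv a" "\<one>" "inv a"];
        simp add: transpose_def s word_simps inv_t t tt)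
qed

lemma ecls_inj_on:
  assumes s: "s1 \<in> carrier G" "s2 \<in> carrier G" "s1 \<otimes> s2 \<noteq> s2 \<otimes> s1"
    and t: "(s1 \<otimes> s2) \<otimes> (s1 \<otimes> s2) = \<one>"
  shows "inj_on (ecls G s1 s2) {1..6}"
proof (rule inj_onI)
  have "s1 \<noteq> s2" using s by auto
  \<comment> \<open>These are the last two entries of the fourth tuple. Their equality would force
    \<open>s2\<close> to be the inverse cube of \<open>s1\<close>, contradicting
    noncommutation.\<close>
  have ne: "inv s2 \<otimes> s1 \<otimes> s2 \<noteq> s1 \<otimes> s2 \<otimes> inv s1"
  proof
    assume eq: "inv s2 \<otimes> s1 \<otimes> s2 = s1 \<otimes> s2 \<otimes> inv s1"
    have "inv s2 = s1 \<otimes> s2 \<otimes> s1"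
      using t s(1,2) by (intro inv_equality) (simp_all add: m_assoc)
    with eq have "(s1 \<otimes> s2) \<otimes> (s1 \<otimes> (s1 \<otimes> s2)) = (s1 \<otimes> s2) \<otimes> inv s1"
      using s(1,2) by (simp add: m_assoc)
    then have "s1 \<otimes> (s1 \<otimes> s2) = inv s1" using s(1,2) by (simp del: m_assoc)
    then have "inv s1 \<otimes> (inv s1 \<otimes> (s1 \<otimes> (s1 \<otimes> s2))) = inv s1 \<otimes> (inv s1 \<otimes> inv s1)" by simp
    then have "s2 = inv s1 \<otimes> (inv s1 \<otimes> inv s1)" using s(1,2) by (simp add: inv_cancel)
    then have "s1 \<otimes> s2 = s2 \<otimes> s1" using s(1) by (simp add: word_simps)
    with s(3) show False ..
  qed
  \<comment> \<open>Each equality would mean \<open>s1 = s2\<close> or that \<open>s1\<close> and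
    \<open>s2\<close> commute.\<close>
  have conj_ne: "s1 \<otimes> s2 \<otimes> inv s1 \<noteq> s1" "s1 \<otimes> s2 \<otimes> inv s1 \<noteq> s2"
    "s2 \<otimes> s1 \<otimes> inv s2 \<noteq> s1" "s2 \<otimes> s1 \<otimes> inv s2 \<noteq> s2"
    "inv s2 \<otimes> s1 \<otimes> s2 \<noteq> s1" "inv s2 \<otimes> s1 \<otimes> s2 \<noteq> s2"
    unfolding conj_eq_iff[OF s(1,2,1)] conj_eq_iff[OF s(1,2,2)]
      conj_eq_iff[OF s(2,1,1)] conj_eq_iff[OF s(2,1,2)]
    using s s(3)[symmetric] \<open>s1 \<noteq> s2\<close> by simp_all
  have ents: "entries (etup G s1 s2 i) \<subseteq> carrier G" for i
    using s by simp
  have coin: "coincidences (etup G s1 s2 1) = [True, False, False, False, False]"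
    "coincidences (etup G s1 s2 2) = [False, True, False, False, False]"
    "coincidences (etup G s1 s2 3) = [False, False, True, False, False]"
    "coincidences (etup G s1 s2 4) = [False, False, False, False, False]"
    "coincidences (etup G s1 s2 5) = [False, False, False, True, False]"
    "coincidences (etup G s1 s2 6) = [False, False, False, False, True]"
    using \<open>s1 \<noteq> s2\<close> ne conj_ne ne[symmetric] conj_ne[symmetric] by simp_all
  fix i j assume ij: "i \<in> {1..6::nat}" "j \<in> {1..6::nat}" "ecls G s1 s2 i = ecls G s1 s2 j"
  then have "etup G s1 s2 i \<in> tcls G (etup G s1 s2 j)"
    unfolding ecls_def using self_in_tcls[OF ents[of i]] by blast
  then have "coincidences (etup G s1 s2 i) = coincidences (etup G s1 s2 j)"
    using coincidences_tconj[OF ents[of j]] unfolding tcls_def by force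
  with ij(1,2) show "i = j"
    unfolding atLeastAtMost_1_6 by (elim insertE emptyE) (simp_all add: coin del: One_nat_def etup.simps)
qed

end

context conj_invariant_subset
begin

lemma etup_nielsen:
  assumes s: "s1 \<in> C" "s2 \<in> C" and t: "(s1 \<otimes> s2) \<otimes> (s1 \<otimes> s2) = \<one>"
    and gen: "generate G {s1, s2} = carrier G"
  shows "etup G s1 s2 i \<in> nielsen G C"
proof -
  have G: "s1 \<in> carrier G" "s2 \<in> carrier G" using s C_closed by blast+
  have C: "entries (etup G s1 s2 i) \<subseteq> C"
    using s G by (simp add: C_conj C_conj')
  then have sub: "entries (etup G s1 s2 i) \<subseteq> carrier G" using C_subset by blast
  \<comment> \<open>Both generators occur literally in each of the six tuples.\<close>
  have "{s1, s2} \<subseteq> entries (etup G s1 s2 i)" by simp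
  from mono_generate[OF this] have "generate G (entries (etup G s1 s2 i)) = carrier G"
    using gen generate_incl[OF sub] by blast
  moreover have "tprod G (etup G s1 s2 i) = \<one>"
  proof -
    define x where "x = s1 \<otimes> s2"
    have x: "x \<in> carrier G" "x \<otimes> x = \<one>" using t G by (simp_all add: x_def)
    have "inv x = x" using x by (simp add: inv_equality)
    moreover have "x \<otimes> (x \<otimes> y) = y" if "y \<in> carrier G" for y
      using that x by (simp flip: m_assoc)
    moreover have "s2 = inv s1 \<otimes> x" using G by (simp add: x_def inv_cancel)
    ultimately show ?thesis using x G by (simp add: word_simps)
  qed
  ultimately show ?thesis using C by (simp add: nielsen_def)
qed

lemma clsmap_ecls:
  assumes "class_bij f" "acts_as s1 s2 f \<pi>" "etup G s1 s2 i \<in> nielsen G C" "i \<in> {1..6}"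
  shows "clsmap f (ecls G s1 s2 i) = ecls G s1 s2 (\<pi> i)"
proof -
  from assms(2,4) obtain g where "g \<in> carrier G" "tconj G g (f (etup G s1 s2 i)) = etup G s1 s2 (\<pi> i)"
    unfolding acts_as_def by blast
  from clsmap_tcls_eqI[OF assms(1,3) this] show ?thesis
    unfolding ecls_def .
qed

end

section \<open>The conjugacy class of \<open>s1\<close>, and assembly of orbit, permutation groups
  and genus\<close>

lemma (in group) conj_invariant_subset_conjcl:
  assumes "x \<in> carrier G"
  shows "conj_invariant_subset G (conjcl G x)"
proof
  show "conjcl G x \<subseteq> carrier G"
    using assms by (auto simp: conjcl_def)
  fix y g assume "y \<in> conjcl G x" and g: "g \<in> carrier G"
  then obtain h where h: "h \<in> carrier G" "y = inv h \<otimes> x \<otimes> h" by (auto simp: conjcl_def)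
  then have "inv g \<otimes> y \<otimes> g = inv (h \<otimes> g) \<otimes> x \<otimes> (h \<otimes> g)"
    using assms g by (simp add: word_simps)
  with g h(1) show "inv g \<otimes> y \<otimes> g \<in> conjcl G x"
    unfolding conjcl_def by blast
qed

theorem theorem3:
  fixes G :: "('a, 'b) monoid_scheme" (structure) and s1 s2 :: 'a
  assumes "group G" and "finite (carrier G)" and "carrier G \<noteq> {\<one>}"
    and "center G = {\<one>}"
    and "s1 \<in> carrier G" and "s2 \<in> carrier G"
    and "generate G {s1, s2} = carrier G"
    and "group.ord G (s1 \<otimes> s2) = 2"
    and "s2 \<in> conjcl G s1"
  shows
   "let C = conjcl G s1; Sig = Sigma_i G C; e = ecls G s1 s2; Z = e ` {1..6};
        \<rho> = (\<lambda>f. rho4 e (clsmap f));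
        B4gens = {b12 G, b13 G, b14 G, b23 G, b24 G, b34 G};
        Bsygens = {b12 G, b13 G, b14 G, br3 G, eta23 G, eta234 G};
        Tgens = {br3 G, eta23 G, eta234 G}
    in Z \<subseteq> Sig \<and> inj_on e {1..6} \<and> card Z = 6
     \<and> perm_orbit Sig (clsmap ` Bsygens) (e 1) = Z
     \<and> \<rho> (b12 G) = cycle_of_list [3, 4] \<circ> cycle_of_list [5, 6]
     \<and> \<rho> (b13 G) = cycle_of_list [1, 2] \<circ> cycle_of_list [5, 6]
     \<and> \<rho> (b14 G) = cycle_of_list [1, 2] \<circ> cycle_of_list [3, 4]
     \<and> \<rho> (br3 G) = cycle_of_list [1, 3, 2, 4]
     \<and> \<rho> (eta23 G) = cycle_of_list [1, 4] \<circ> cycle_of_list [2, 3] \<circ> cycle_of_list [5, 6]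
     \<and> \<rho> (eta234 G) = cycle_of_list [1, 6, 4] \<circ> cycle_of_list [2, 5, 3]
     \<and> subgroup_generated (sym_group 6) (\<rho> ` B4gens)
         \<cong> integer_mod_group 2 \<times>\<times> integer_mod_group 2
     \<and> carrier (subgroup_generated (sym_group 6) (\<rho> ` B4gens)) \<subseteq> carrier (alt_group 6)
     \<and> subgroup_generated (sym_group 6) (\<rho> ` Bsygens) \<cong> sym_group 4
     \<and> subgroup_generated (sym_group 6) (\<rho> ` Tgens) \<cong> sym_group 4
     \<and> 1 - real (card Z) + (3 * real (card Z) - real (ncycles Z (clsmap (br3 G)))
          - real (ncycles Z (clsmap (eta23 G))) - real (ncycles Z (clsmap (eta234 G)))) / 2 = 0"
proof -
  interpret group G by fact
  define C where "C = conjcl G s1"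
  interpret conj_invariant_subset G C
    unfolding C_def by (rule conj_invariant_subset_conjcl) fact
  define e where "e = ecls G s1 s2"
  define Z where "Z = e ` {1..6}"
  define \<rho> where "\<rho> = (\<lambda>f. rho4 e (clsmap f))"
  have t: "(s1 \<otimes> s2) \<otimes> (s1 \<otimes> s2) = \<one>"
    using pow_ord_eq_1[of "s1 \<otimes> s2"] assms(5,6,8) by (simp add: numeral_2_eq_2)
  have s2: "s2 = inv s1 \<otimes> (s1 \<otimes> s2)" using assms(5,6) by (simp add: inv_cancel)
  have s1C: "s1 \<in> C"
    unfolding C_def conjcl_def using assms(5) by (auto intro!: exI[of _ \<one>])
  have s2C: "s2 \<in> C" unfolding C_def by fact
  note N = etup_nielsen[OF s1C s2C t assms(7)]
  have inj: "inj_on e {1..6}"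
    unfolding e_def
    using ecls_inj_on[OF assms(5,6) noncommuting_generators[OF assms(3,4,5,6,7)] t] .
  have card: "card Z = 6" unfolding Z_def using inj by (simp add: card_image)
  have sub: "Z \<subseteq> Sigma_i G C"
    unfolding Z_def e_def ecls_def Sigma_i_eq using N by blast
  have cls: "clsmap f (e i) = e (\<pi> i)" if "class_bij f" "acts_as s1 s2 f \<pi>" "i \<in> {1..6}" for f \<pi> i
    unfolding e_def using clsmap_ecls[OF that(1,2) N that(3)] .
  have rho: "\<rho> f = \<pi>" if "class_bij f" "acts_as s1 s2 f \<pi>" "\<pi> permutes {1..6}" for f \<pi>
    unfolding \<rho>_def using inj that(3) cls[OF that(1,2)] by (rule rho4_eqI)
  note table = acts_as_table[OF assms(5) m_closed[OF assms(5,6)] t s2]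
  have perms: "cycle_of_list [3, 4] \<circ> cycle_of_list [5, 6] permutes {1..6::nat}"
    "cycle_of_list [1, 2] \<circ> cycle_of_list [5, 6] permutes {1..6::nat}"
    "cycle_of_list [1, 2] \<circ> cycle_of_list [3, 4] permutes {1..6::nat}"
    "cycle_of_list [1, 3, 2, 4] permutes {1..6::nat}"
    "cycle_of_list [1, 4] \<circ> cycle_of_list [2, 3] \<circ> cycle_of_list [5, 6] permutes {1..6::nat}"
    "cycle_of_list [1, 6, 4] \<circ> cycle_of_list [2, 5, 3] permutes {1..6::nat}"
    by (intro permutes_compose cycle_of_list_permutes; simp)+
  note bij = class_bij_generators
  note \<rho>s = rho[OF bij(8) table(1) perms(1)] rho[OF bij(9) table(2) perms(2)]
    rho[OF bij(10) table(3) perms(3)] rho[OF bij(11) table(4) perms(3)]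
    rho[OF bij(12) table(5) perms(2)] rho[OF bij(13) table(6) perms(1)]
    rho[OF bij(3) table(7) perms(4)] rho[OF bij(6) table(8) perms(5)]
    rho[OF bij(7) table(9) perms(6)]
  let ?T = "{br3 G, eta23 G, eta234 G}"
  let ?B = "{b12 G, b13 G, b14 G, br3 G, eta23 G, eta234 G}"
  let ?P = "{b12 G, b13 G, b14 G, b23 G, b24 G, b34 G}"
  have \<rho>P: "\<rho> ` ?P = {cycle_of_list [3, 4] \<circ> cycle_of_list [5, 6],
      cycle_of_list [1, 2] \<circ> cycle_of_list [5, 6], cycle_of_list [1, 2] \<circ> cycle_of_list [3, 4]}"
    \<comment> \<open>Complementary pure braids, such as \<open>b12\<close> and \<open>b34\<close>,
      induce the same permutation, so six generators have three images.\<close>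
    unfolding image_insert image_empty \<rho>s by blast
  have \<rho>T: "\<rho> ` ?T = {cycle_of_list [1, 3, 2, 4],
      cycle_of_list [1, 4] \<circ> cycle_of_list [2, 3] \<circ> cycle_of_list [5, 6],
      cycle_of_list [1, 6, 4] \<circ> cycle_of_list [2, 5, 3]}"
    unfolding image_insert image_empty \<rho>s ..
  have TB: "\<rho> ` ?T \<subseteq> \<rho> ` ?B" by blast
  have "cycle_of_list [1, 3, 2, 4] \<in> \<rho> ` ?T"
    "cycle_of_list [1, 6, 4] \<circ> cycle_of_list [2, 5, 3] \<in> \<rho> ` ?T"
    unfolding \<rho>T by blast+
  note dt = double_transpositions_in_octahedral[OF this]
  have "\<rho> (b12 G) \<in> generate (sym_group 6) (\<rho> ` ?T)"
    "\<rho> (b13 G) \<in> generate (sym_group 6) (\<rho> ` ?T)"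
    "\<rho> (b14 G) \<in> generate (sym_group 6) (\<rho> ` ?T)"
    unfolding \<rho>s(1-3) by (rule dt)+
  moreover have "\<rho> ` ?T \<subseteq> generate (sym_group 6) (\<rho> ` ?T)" by (blast intro: generate.incl)
  ultimately have BT: "\<rho> ` ?B \<subseteq> generate (sym_group 6) (\<rho> ` ?T)" by blast
  have orbit: "perm_orbit (Sigma_i G C) (clsmap ` ?B) (e 1) = Z"
  proof (rule perm_orbit_eqI[OF _ sub])
    show "bij_betw f (Sigma_i G C) (Sigma_i G C)" if "f \<in> clsmap ` ?B" for f
      using that clsmap_bij_betw bij by blast
    show "finite Z" "e 1 \<in> Z" by (simp_all add: Z_def)
    have closed: "clsmap f z \<in> Z"
      if "class_bij f" "acts_as s1 s2 f \<pi>" "\<pi> permutes {1..6}" "z \<in> Z" for f \<pi> z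
    proof -
      from that(4) obtain i where i: "i \<in> {1..6}" "z = e i" unfolding Z_def by blast
      then have "clsmap f z = e (\<pi> i)" "\<pi> i \<in> {1..6}"
        using cls[OF that(1,2)] permutes_in_image[OF that(3)] by blast+
      then show ?thesis unfolding Z_def by blast
    qed
    note closeds = closed[OF bij(8) table(1) perms(1)] closed[OF bij(9) table(2) perms(2)]
      closed[OF bij(10) table(3) perms(3)] closed[OF bij(3) table(7) perms(4)]
      closed[OF bij(6) table(8) perms(5)] closed[OF bij(7) table(9) perms(6)]
    show "f z \<in> Z" if "f \<in> clsmap ` ?B" "z \<in> Z" for f z
      using that(1) by (elim imageE insertE emptyE) (simp_all only: closeds[OF that(2)])
    fix Y assume "e 1 \<in> Y"
      and step: "\<And>f y. f \<in> clsmap ` ?B \<Longrightarrow> y \<in> Y \<Longrightarrow> y \<in> Z \<Longrightarrow> f y \<in> Y"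
    have eZ: "e i \<in> Z" if "i \<in> {1..6}" for i using that by (simp add: Z_def)
    have r: "e (cycle_of_list [1, 3, 2, 4] i) \<in> Y" if "e i \<in> Y" "i \<in> {1..6}" for i
      using step[of "clsmap (br3 G)", OF _ that(1) eZ[OF that(2)]] cls[OF bij(3) table(7) that(2)] by simp
    have h: "e ((cycle_of_list [1, 6, 4] \<circ> cycle_of_list [2, 5, 3]) i) \<in> Y"
      if "e i \<in> Y" "i \<in> {1..6}" for i
      using step[of "clsmap (eta234 G)", OF _ that(1) eZ[OF that(2)]] cls[OF bij(7) table(9) that(2)] by simp
    \<comment> \<open>The 4-cycle runs through 1, 3, 2, 4; the product of 3-cycles then leads from 1
      to 6 and from 2 to 5.\<close>
    have 3: "e 3 \<in> Y" using r[of 1] \<open>e 1 \<in> Y\<close> by (simp add: transpose_def)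
    have 2: "e 2 \<in> Y" using r[of 3] 3 by (simp add: transpose_def)
    have 4: "e 4 \<in> Y" using r[of 2] 2 by (simp add: transpose_def)
    have 6: "e 6 \<in> Y" using h[of 1] \<open>e 1 \<in> Y\<close> by (simp add: transpose_def)
    have 5: "e 5 \<in> Y" using h[of 2] 2 by (simp add: transpose_def)
    show "Z \<subseteq> Y"
      unfolding Z_def atLeastAtMost_1_6 using \<open>e 1 \<in> Y\<close> 2 3 4 5 6 by simp
  qed
  have nc: "ncycles Z (clsmap f) = ncycles {1..6} \<pi>"
    if "class_bij f" "acts_as s1 s2 f \<pi>" "\<pi> permutes {1..6}" for f \<pi>
    unfolding Z_def
    by (rule ncycles_image[OF inj]) (use permutes_in_image[OF that(3)] cls[OF that(1,2)] in blast)+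
  have "1 - real (card Z) + (3 * real (card Z) - real (ncycles Z (clsmap (br3 G)))
          - real (ncycles Z (clsmap (eta23 G))) - real (ncycles Z (clsmap (eta234 G)))) / 2 = 0"
    \<comment> \<open>The cycle counts are 3, 3 and 2, so the genus is 1 - 6 + (18 - 8)/2 =
      0.\<close>
    unfolding nc[OF bij(3) table(7) perms(4)] nc[OF bij(6) table(8) perms(5)]
      nc[OF bij(7) table(9) perms(6)] ncycles_generators card by simp
  moreover have "subgroup_generated (sym_group 6) (\<rho> ` ?T) \<cong> sym_group 4"
    by (rule subgroup_generated_octahedral[OF \<rho>T subset_refl]) (blast intro: generate.incl)
  ultimately show ?thesis
    using sub inj card orbit \<rho>s(1,2,3,7,8,9)[unfolded \<rho>_def] klein_four[folded \<rho>P]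
      subgroup_generated_octahedral[OF \<rho>T TB BT]
    unfolding Let_def C_def[symmetric] e_def[symmetric] Z_def[symmetric] \<rho>_def[symmetric]
    by (intro conjI)
qed

end
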